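(* The dynamic $s$-$t$-reachability query is not in $\mathrm{DynPropCQ}$, i.e., it cannot be maintained by a dynamic program all of whose update formulas are conjunctions of atomic formulas (no negation, no disjunction, no quantifiers).
   Context: An $s$-$t$-graph is a structure over the schema with one binary relation symbol $E$ and two constants $s,t$; the $s$-$t$-reachability query is true iff there is a directed path from $s$ to $t$. Dynamic setting: input and auxiliary schemas are relational, no built-in data, no auxiliary functions. Concrete modifications insert or delete a single tuple of an input relation (constants never modified). An update program has, for every auxiliary relation symbol $R$ and every abstract modification $\delta\in\{\mathrm{ins}_S,\mathrm{del}_S\}$, $S$ an input relation symbol, a formula $\varphi^R_\delta(\vec x;\vec y)$ over the input and auxiliary schema; after $\delta(\vec a)$, the input is modified and $R$ becomes $\{\vec b:\text{old state}\models\varphi^R_\delta(\vec a;\vec b)\}$. A dynamic program has an arbitrary initialization mapping from input databases to auxiliary databases over the same domain and a query symbol $Q$; it maintains a query if for every input database $\mathcal D$ and every finite modification sequence $\alpha$, $Q$ after applying $\alpha$ to the initial state equals the query answer on $\alpha(\mathcal D)$. $\mathrm{DynPropCQ}$ is the class of queries maintainable by such programs whose update formulas are conjunctive (conjunctions of literals) and negation-free, i.e., conjunctions of atomic formulas. *)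

theory Defs
  imports Main
begin

datatype 'c trm = Var nat | Const 'c

datatype ('r, 'c) fm =
    Pred 'r "'c trm list"
  | Equal "'c trm" "'c trm"
  | Neg "('r, 'c) fm"
  | Conj "('r, 'c) fm" "('r, 'c) fm"
  | Disj "('r, 'c) fm" "('r, 'c) fm"
  | Exists nat "('r, 'c) fm"
  | Forall nat "('r, 'c) fm"

fun fv_trm :: "'c trm \<Rightarrow> nat set" where
  "fv_trm (Var i) = {i}"
| "fv_trm (Const c) = {}"

fun fv :: "('r, 'c) fm \<Rightarrow> nat set" where
  "fv (Pred R ts) = (\<Union>t\<in>set ts. fv_trm t)"
| "fv (Equal t u) = fv_trm t \<union> fv_trm u"
| "fv (Neg \<phi>) = fv \<phi>"
| "fv (Conj \<phi> \<psi>) = fv \<phi> \<union> fv \<psi>"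
| "fv (Disj \<phi> \<psi>) = fv \<phi> \<union> fv \<psi>"
| "fv (Exists i \<phi>) = fv \<phi> - {i}"
| "fv (Forall i \<phi>) = fv \<phi> - {i}"

fun over_schema :: "'r set \<Rightarrow> ('r \<Rightarrow> nat) \<Rightarrow> ('r, 'c) fm \<Rightarrow> bool" where
  "over_schema \<Sigma> ar (Pred R ts) \<longleftrightarrow> R \<in> \<Sigma> \<and> length ts = ar R"
| "over_schema \<Sigma> ar (Equal t u) \<longleftrightarrow> True"
| "over_schema \<Sigma> ar (Neg \<phi>) \<longleftrightarrow> over_schema \<Sigma> ar \<phi>"
| "over_schema \<Sigma> ar (Conj \<phi> \<psi>) \<longleftrightarrow> over_schema \<Sigma> ar \<phi> \<and> over_schema \<Sigma> ar \<psi>"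
| "over_schema \<Sigma> ar (Disj \<phi> \<psi>) \<longleftrightarrow> over_schema \<Sigma> ar \<phi> \<and> over_schema \<Sigma> ar \<psi>"
| "over_schema \<Sigma> ar (Exists i \<phi>) \<longleftrightarrow> over_schema \<Sigma> ar \<phi>"
| "over_schema \<Sigma> ar (Forall i \<phi>) \<longleftrightarrow> over_schema \<Sigma> ar \<phi>"

fun atomic :: "('r, 'c) fm \<Rightarrow> bool" where
  "atomic (Pred R ts) \<longleftrightarrow> True"
| "atomic (Equal t u) \<longleftrightarrow> True"
| "atomic _ \<longleftrightarrow> False"

fun is_literal :: "('r, 'c) fm \<Rightarrow> bool" where
  "is_literal (Neg \<phi>) \<longleftrightarrow> atomic \<phi>"
| "is_literal \<phi> \<longleftrightarrow> atomic \<phi>"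

fun conjunctive :: "('r, 'c) fm \<Rightarrow> bool" where
  "conjunctive (Conj \<phi> \<psi>) \<longleftrightarrow> conjunctive \<phi> \<and> conjunctive \<psi>"
| "conjunctive \<phi> \<longleftrightarrow> is_literal \<phi>"

fun negation_free :: "('r, 'c) fm \<Rightarrow> bool" where
  "negation_free (Pred R ts) \<longleftrightarrow> True"
| "negation_free (Equal t u) \<longleftrightarrow> True"
| "negation_free (Neg \<phi>) \<longleftrightarrow> False"
| "negation_free (Conj \<phi> \<psi>) \<longleftrightarrow> negation_free \<phi> \<and> negation_free \<psi>"
| "negation_free (Disj \<phi> \<psi>) \<longleftrightarrow> negation_free \<phi> \<and> negation_free \<psi>"
| "negation_free (Exists i \<phi>) \<longleftrightarrow> negation_free \<phi>"
| "negation_free (Forall i \<phi>) \<longleftrightarrow> negation_free \<phi>"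

record ('a, 'r, 'c) db =
  univ :: "'a set"
  interp :: "'r \<Rightarrow> 'a list set"
  cval :: "'c \<Rightarrow> 'a"

definition tuples :: "'a set \<Rightarrow> nat \<Rightarrow> 'a list set" where
  "tuples U k = {xs. length xs = k \<and> set xs \<subseteq> U}"

definition is_db :: "('r \<Rightarrow> nat) \<Rightarrow> ('a, 'r, 'c) db \<Rightarrow> bool" where
  "is_db ar D \<longleftrightarrow> finite (univ D) \<and> univ D \<noteq> {} \<and>
     (\<forall>R. interp D R \<subseteq> tuples (univ D) (ar R)) \<and> (\<forall>c. cval D c \<in> univ D)"

fun eval_trm :: "('a, 'r, 'c) db \<Rightarrow> (nat \<Rightarrow> 'a) \<Rightarrow> 'c trm \<Rightarrow> 'a" where
  "eval_trm D v (Var i) = v i"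
| "eval_trm D v (Const c) = cval D c"

fun sat :: "('a, 'r, 'c) db \<Rightarrow> (nat \<Rightarrow> 'a) \<Rightarrow> ('r, 'c) fm \<Rightarrow> bool" where
  "sat D v (Pred R ts) \<longleftrightarrow> map (eval_trm D v) ts \<in> interp D R"
| "sat D v (Equal t u) \<longleftrightarrow> eval_trm D v t = eval_trm D v u"
| "sat D v (Neg \<phi>) \<longleftrightarrow> \<not> sat D v \<phi>"
| "sat D v (Conj \<phi> \<psi>) \<longleftrightarrow> sat D v \<phi> \<and> sat D v \<psi>"
| "sat D v (Disj \<phi> \<psi>) \<longleftrightarrow> sat D v \<phi> \<or> sat D v \<psi>"
| "sat D v (Exists i \<phi>) \<longleftrightarrow> (\<exists>d\<in>univ D. sat D (v(i := d)) \<phi>)"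
| "sat D v (Forall i \<phi>) \<longleftrightarrow> (\<forall>d\<in>univ D. sat D (v(i := d)) \<phi>)"

datatype 'r abs_mod = Ins (sym: 'r) | Del (sym: 'r)

type_synonym ('a, 'r) modification = "'r abs_mod \<times> 'a list"

fun apply_mod :: "('a, 'r) modification \<Rightarrow> ('a, 'r, 'c) db \<Rightarrow> ('a, 'r, 'c) db" where
  "apply_mod (Ins S, a) D = D\<lparr>interp := (interp D)(S := interp D S \<union> {a})\<rparr>"
| "apply_mod (Del S, a) D = D\<lparr>interp := (interp D)(S := interp D S - {a})\<rparr>"

definition valid_mod :: "('r \<Rightarrow> nat) \<Rightarrow> 'a set \<Rightarrow> ('a, 'r) modification \<Rightarrow> bool" where
  "valid_mod ar U m \<longleftrightarrow> snd m \<in> tuples U (ar (sym (fst m)))"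

text \<open>
  Auxiliary relation symbols are natural numbers; the auxiliary schema is a finite set
  \<open>aux_syms\<close> of them with arities \<open>aux_ar\<close>. Formulas over the input and the auxiliary schema
  use symbols of type \<^typ>\<open>'r + nat\<close>. Values of \<open>aux_ar\<close>, \<open>upd\<close> and \<open>init\<close> at symbols outside
  \<open>aux_syms\<close> are irrelevant. In the update formula \<open>upd R \<delta>\<close> for a modification with a tuple of
  length \<open>m\<close>, the variables \<open>0, \<dots>, m - 1\<close> are the parameters of the modification
  and the next \<open>aux_ar R\<close> variables are those of the tuple tested for membership in \<open>R\<close>.
\<close>

type_synonym 'a aux_db = "nat \<Rightarrow> 'a list set"

record ('a, 'r, 'c) dyn_program =
  aux_syms :: "nat set"
  aux_ar :: "nat \<Rightarrow> nat"
  upd :: "nat \<Rightarrow> 'r abs_mod \<Rightarrow> ('r + nat, 'c) fm"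
  init :: "('a, 'r, 'c) db \<Rightarrow> 'a aux_db"
  query_sym :: nat

definition is_dyn_program :: "('r \<Rightarrow> nat) \<Rightarrow> ('a, 'r, 'c) dyn_program \<Rightarrow> bool" where
  "is_dyn_program ar P \<longleftrightarrow>
     finite (aux_syms P) \<and> query_sym P \<in> aux_syms P \<and>
     (\<forall>R\<in>aux_syms P. \<forall>\<delta>.
        over_schema (UNIV <+> aux_syms P) (case_sum ar (aux_ar P)) (upd P R \<delta>) \<and>
        fv (upd P R \<delta>) \<subseteq> {..<ar (sym \<delta>) + aux_ar P R}) \<and>
     (\<forall>D. is_db ar D \<longrightarrow> (\<forall>R\<in>aux_syms P. init P D R \<subseteq> tuples (univ D) (aux_ar P R)))"

type_synonym ('a, 'r, 'c) state = "('a, 'r, 'c) db \<times> 'a aux_db"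

definition state_db :: "('a, 'r, 'c) state \<Rightarrow> ('a, 'r + nat, 'c) db" where
  "state_db S = \<lparr>univ = univ (fst S), interp = case_sum (interp (fst S)) (snd S),
                 cval = cval (fst S)\<rparr>"

definition step ::
    "('a, 'r, 'c) dyn_program \<Rightarrow> ('a, 'r) modification \<Rightarrow> ('a, 'r, 'c) state \<Rightarrow> ('a, 'r, 'c) state"
  where
  "step P m S =
     (apply_mod m (fst S),
      \<lambda>R. {b \<in> tuples (univ (fst S)) (aux_ar P R).
             sat (state_db S) (\<lambda>i. (snd m @ b) ! i) (upd P R (fst m))})"

type_synonym ('a, 'r, 'c) query = "('a, 'r, 'c) db \<Rightarrow> 'a list set"

definition maintains ::
    "('r \<Rightarrow> nat) \<Rightarrow> ('a, 'r, 'c) dyn_program \<Rightarrow> ('a, 'r, 'c) query \<Rightarrow> bool" where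
  "maintains ar P q \<longleftrightarrow>
     (\<forall>D \<alpha>. is_db ar D \<longrightarrow> (\<forall>m\<in>set \<alpha>. valid_mod ar (univ D) m) \<longrightarrow>
        snd (fold (step P) \<alpha> (D, init P D)) (query_sym P) = q (fold apply_mod \<alpha> D))"

text \<open>
  The input schema consists of all symbols of the finite types \<^typ>\<open>'r\<close> and \<^typ>\<open>'c\<close>, with arities
  \<open>ar\<close>. The domains of databases range over all nonempty finite subsets of \<^typ>\<open>'a\<close>.
\<close>

definition DynPropCQ ::
    "('r::finite \<Rightarrow> nat) \<Rightarrow> nat \<Rightarrow> ('a, 'r, 'c::finite) query set" where
  "DynPropCQ ar k =
     {q. \<exists>P. is_dyn_program ar P \<and> aux_ar P (query_sym P) = k \<and>
         (\<forall>R\<in>aux_syms P. \<forall>\<delta>. conjunctive (upd P R \<delta>) \<and> negation_free (upd P R \<delta>)) \<and>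
         maintains ar P q}"

datatype st_rel = E

datatype st_const = s_const | t_const

instance st_rel :: finite
proof
  have "(UNIV :: st_rel set) = {E}"
    by (auto intro: st_rel.exhaust)
  then show "finite (UNIV :: st_rel set)"
    by (metis finite.emptyI finite.insertI)
qed

instance st_const :: finite
proof
  have "(UNIV :: st_const set) = {s_const, t_const}"
    by (auto intro: st_const.exhaust)
  then show "finite (UNIV :: st_const set)"
    by (metis finite.emptyI finite.insertI)
qed

fun st_arity :: "st_rel \<Rightarrow> nat" where
  "st_arity E = 2"

type_synonym 'a st_graph = "('a, st_rel, st_const) db"

definition edges :: "'a st_graph \<Rightarrow> ('a \<times> 'a) set" where
  "edges G = {(u, v). [u, v] \<in> interp G E}"

text \<open>A Boolean query is a \<open>0\<close>-ary one; \<open>{[]}\<close> stands for true and \<open>{}\<close> for false.\<close>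

definition st_reach :: "'a st_graph \<Rightarrow> 'a list set" where
  "st_reach G = (if (cval G s_const, cval G t_const) \<in> (edges G)\<^sup>* then {[]} else {})"

end

theory Submission
  imports Defs
begin

text \<open>
  Take a graph with edges \<open>s \<rightarrow> a \<rightarrow> t\<close> for every \<open>a\<close> in a set \<open>A\<close> that is larger than all arities,
  plus an isolated node \<open>c\<close>. Deleting all edges \<open>s \<rightarrow> a\<close> disconnects \<open>t\<close> from \<open>s\<close>. For \<open>j \<in> A\<close>, the
  \<open>j\<close>-th variant of this run deletes the non-edge \<open>s \<rightarrow> c\<close> in place of \<open>s \<rightarrow> j\<close>, so \<open>t\<close> stays reachable.
  An invariant relates the runs: a tuple \<open>b\<close> is in a relation of the original run whenever, for
  every \<open>j\<close>, the tuple \<open>b[j := c]\<close> is in that relation of the \<open>j\<close>-th variant. It holds initially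
  since \<open>b\<close> omits some \<open>j \<in> A\<close>, and conjunctions of atoms preserve it. As the query bit is
  true in all variants, it is true in the original run, where it has to be false.
\<close>

text \<open>Equivalently, the map sending \<open>x\<close> in \<open>W\<close> to the family of all
  \<open>f j x\<close> reflects each relation of \<open>\<Sigma>\<close> from the direct product of
  the \<open>D' j\<close> back to \<open>D\<close>. Restricting to \<open>W\<close> leaves room for
  elements on which some \<open>f j\<close> is not injective.\<close>

definition jointly_reflects ::
    "'j set \<Rightarrow> ('j \<Rightarrow> 'a \<Rightarrow> 'a) \<Rightarrow> 'a set \<Rightarrow> 'r set \<Rightarrow> ('r \<Rightarrow> nat) \<Rightarrow>
      ('a, 'r, 'c) db \<Rightarrow> ('j \<Rightarrow> ('a, 'r, 'c) db) \<Rightarrow> bool" where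
  "jointly_reflects J f W \<Sigma> ar D D' \<longleftrightarrow>
     W \<subseteq> univ D \<and> range (cval D) \<subseteq> W \<and>
     (\<forall>j\<in>J. inj_on (f j) W \<and> (\<forall>c. cval (D' j) c = f j (cval D c))) \<and>
     (\<forall>R\<in>\<Sigma>. \<forall>b\<in>tuples W (ar R). (\<forall>j\<in>J. map (f j) b \<in> interp (D' j) R) \<longrightarrow> b \<in> interp D R)"

lemma jointly_reflectsD:
  assumes "jointly_reflects J f W \<Sigma> ar D D'" and "R \<in> \<Sigma>" and "b \<in> tuples W (ar R)"
    and "\<And>j. j \<in> J \<Longrightarrow> map (f j) b \<in> interp (D' j) R"
  shows "b \<in> interp D R"
  using assms by (simp add: jointly_reflects_def)

lemma jointly_reflects_trm:
  assumes "jointly_reflects J f W \<Sigma> ar D D'"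
    and "\<And>i. i \<in> fv_trm t \<Longrightarrow> v i \<in> W"
  shows "eval_trm D v t \<in> W"
    and "j \<in> J \<Longrightarrow> (\<And>i. i \<in> fv_trm t \<Longrightarrow> v' i = f j (v i)) \<Longrightarrow>
         eval_trm (D' j) v' t = f j (eval_trm D v t)"
  using assms by (cases t; auto simp: jointly_reflects_def)+

text \<open>A conjunction true in every \<open>D' j\<close> has each conjunct true in every
  \<open>D' j\<close>, so reflection works atom by atom; a disjunction could hold through different
  disjuncts for different \<open>j\<close>. Relational atoms use the joint reflection, equalities
  the injectivity of a single \<open>f j\<close>, whence \<open>J\<close> must be nonempty.\<close>

lemma jointly_reflects_sat:
  assumes refl: "jointly_reflects J f W \<Sigma> ar D D'" and ne: "J \<noteq> {}"
    and "conjunctive \<phi>" "negation_free \<phi>" "over_schema \<Sigma> ar \<phi>"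
    and "\<And>i. i \<in> fv \<phi> \<Longrightarrow> v i \<in> W"
    and "\<And>i j. i \<in> fv \<phi> \<Longrightarrow> j \<in> J \<Longrightarrow> v' j i = f j (v i)"
    and "\<And>j. j \<in> J \<Longrightarrow> sat (D' j) (v' j) \<phi>"
  shows "sat D v \<phi>"
  using assms(3-)
proof (induction \<phi>)
  case (Pred R ts)
  have trm: "eval_trm D v t \<in> W"
    "j \<in> J \<Longrightarrow> eval_trm (D' j) (v' j) t = f j (eval_trm D v t)" if "t \<in> set ts" for t j
    using that Pred.prems by (auto intro!: jointly_reflects_trm[OF refl])
  have "map (eval_trm D v) ts \<in> tuples W (ar R)"
    using Pred.prems(3) trm(1) by (auto simp: tuples_def)
  moreover have "map (f j) (map (eval_trm D v) ts) \<in> interp (D' j) R" if "j \<in> J" for j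
  proof -
    have "map (f j) (map (eval_trm D v) ts) = map (eval_trm (D' j) (v' j)) ts"
      using trm(2) that by simp
    then show ?thesis
      using Pred.prems(6)[OF that] by (simp only: sat.simps)
  qed
  ultimately show ?case
    using refl Pred.prems(3) by (simp add: jointly_reflects_def)
next
  case (Equal t u)
  obtain j where j: "j \<in> J"
    using ne by blast
  have W: "eval_trm D v t \<in> W" "eval_trm D v u \<in> W"
    using Equal.prems by (auto intro!: jointly_reflects_trm[OF refl])
  have "eval_trm (D' j) (v' j) t = f j (eval_trm D v t)"
    "eval_trm (D' j) (v' j) u = f j (eval_trm D v u)"
    by (rule jointly_reflects_trm(2)[OF refl _ j]; simp add: Equal.prems j)+
  then have "f j (eval_trm D v t) = f j (eval_trm D v u)"
    using Equal.prems(6)[OF j] by simp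
  moreover have "inj_on (f j) W"
    using refl j by (simp add: jointly_reflects_def)
  ultimately show ?case
    using W by (simp add: inj_on_eq_iff)
\<comment> \<open>\<open>Conj\<close> follows from the induction hypotheses;
  \<open>negation_free\<close> excludes \<open>Neg\<close>, and \<open>conjunctive\<close> excludes
  disjunctions and quantifiers.\<close>
qed auto

text \<open>Input relations: a tuple whose images survive all the deletions cannot be
  \<open>a\<close>, because the image of \<open>a\<close> is exactly what run \<open>j\<close>
  deletes. Auxiliary relations: the update formula is a conjunction of atoms, so its truth transfers
  from the runs \<open>S' j\<close> to \<open>S\<close>.\<close>

lemma jointly_reflects_step_Del:
  assumes refl: "jointly_reflects J f W (UNIV <+> aux_syms P) (case_sum ar (aux_ar P))
      (state_db S) (\<lambda>j. state_db (S' j))"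
    and ne: "J \<noteq> {}" and prog: "is_dyn_program ar P"
    and cq: "\<forall>R\<in>aux_syms P. \<forall>\<delta>. conjunctive (upd P R \<delta>) \<and> negation_free (upd P R \<delta>)"
    and a: "a \<in> tuples W (ar X)"
  shows "jointly_reflects J f W (UNIV <+> aux_syms P) (case_sum ar (aux_ar P))
      (state_db (step P (Del X, a) S)) (\<lambda>j. state_db (step P (Del X, map (f j) a) (S' j)))"
proof -
  have input: "b \<in> interp (apply_mod (Del X, a) (fst S)) R"
    if "b \<in> tuples W (ar R)"
      and "\<forall>j\<in>J. map (f j) b \<in> interp (apply_mod (Del X, map (f j) a) (fst (S' j))) R" for R b
  proof -
    have "b \<in> interp (fst S) R"
    proof -
      have "\<forall>j\<in>J. map (f j) b \<in> interp (fst (S' j)) R"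
        using that(2) by (auto split: if_splits)
      then show ?thesis
        using jointly_reflectsD[OF refl, of "Inl R" b] that(1) by (auto simp: state_db_def)
    qed
    moreover have "R = X \<longrightarrow> b \<noteq> a"
      using that(2) ne by auto
    ultimately show ?thesis
      by auto
  qed
  have aux: "b \<in> snd (step P (Del X, a) S) R"
    if R: "R \<in> aux_syms P" and b: "b \<in> tuples W (aux_ar P R)"
      and *: "\<forall>j\<in>J. map (f j) b \<in> snd (step P (Del X, map (f j) a) (S' j)) R" for R b
  proof -
    have upd: "over_schema (UNIV <+> aux_syms P) (case_sum ar (aux_ar P)) (upd P R (Del X))"
      "fv (upd P R (Del X)) \<subseteq> {..<length (a @ b)}"
      using prog R a b by (force simp: is_dyn_program_def tuples_def)+
    have "sat (state_db S) (\<lambda>i. (a @ b) ! i) (upd P R (Del X))"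
    proof (rule jointly_reflects_sat[OF refl ne])
      show "conjunctive (upd P R (Del X))" "negation_free (upd P R (Del X))"
        using cq R by auto
      show "over_schema (UNIV <+> aux_syms P) (case_sum ar (aux_ar P)) (upd P R (Del X))"
        by (fact upd)
      show "(a @ b) ! i \<in> W" if "i \<in> fv (upd P R (Del X))" for i
      proof -
        have "(a @ b) ! i \<in> set (a @ b)"
          using that upd(2) by (intro nth_mem) auto
        then show ?thesis
          using a b by (auto simp: tuples_def)
      qed
      show "(map (f j) a @ map (f j) b) ! i = f j ((a @ b) ! i)"
        if "i \<in> fv (upd P R (Del X))" for i j
      proof -
        have "i < length (a @ b)"
          using that upd(2) by auto
        then show ?thesis
          by (metis map_append nth_map)
      qed
      show "sat (state_db (S' j)) (\<lambda>i. (map (f j) a @ map (f j) b) ! i) (upd P R (Del X))"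
        if "j \<in> J" for j
        using * that by (simp add: step_def)
    qed
    \<comment> \<open>\<open>step\<close> only admits tuples over the universe, which is where
      \<open>W \<subseteq> univ D\<close> enters.\<close>
    moreover have "b \<in> tuples (univ (fst S)) (aux_ar P R)"
      using b refl by (auto simp: jointly_reflects_def state_db_def tuples_def)
    ultimately show ?thesis
      by (simp add: step_def)
  qed
  show ?thesis
    unfolding jointly_reflects_def
  proof (intro conjI ballI impI)
    show "b \<in> interp (state_db (step P (Del X, a) S)) R"
      if "R \<in> UNIV <+> aux_syms P" "b \<in> tuples W (case_sum ar (aux_ar P) R)"
        and "\<forall>j\<in>J. map (f j) b \<in> interp (state_db (step P (Del X, map (f j) a) (S' j))) R" for R b
    proof (cases R)
      case (Inl Y)
      then show ?thesis
        using that(2,3) input[of b Y] by (simp add: state_db_def step_def)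
    next
      case (Inr Y)
      then show ?thesis
        using that aux[of Y b] by (auto simp: state_db_def)
    qed
  qed (use refl in \<open>simp_all add: jointly_reflects_def state_db_def step_def\<close>)
qed

lemma jointly_reflects_fold_Del:
  assumes "J \<noteq> {}" and "is_dyn_program ar P"
    and "\<forall>R\<in>aux_syms P. \<forall>\<delta>. conjunctive (upd P R \<delta>) \<and> negation_free (upd P R \<delta>)"
    and "set as \<subseteq> tuples W (ar X)"
    and "jointly_reflects J f W (UNIV <+> aux_syms P) (case_sum ar (aux_ar P))
      (state_db S) (\<lambda>j. state_db (S' j))"
  shows "jointly_reflects J f W (UNIV <+> aux_syms P) (case_sum ar (aux_ar P))
      (state_db (fold (step P) (map (Pair (Del X)) as) S))
      (\<lambda>j. state_db (fold (step P) (map (\<lambda>a. (Del X, map (f j) a)) as) (S' j)))"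
  using assms(4,5)
proof (induction as arbitrary: S S')
  case (Cons a as)
  have "a \<in> tuples W (ar X)"
    using Cons.prems(1) by simp
  note step = jointly_reflects_step_Del[OF Cons.prems(2) assms(1-3) this]
  show ?case
    using Cons.IH[OF _ step] Cons.prems(1) by simp
qed simp

lemma fold_apply_mod_Del:
  "fold apply_mod (map (Pair (Del X)) as) D =
     D\<lparr>interp := (interp D)(X := interp D X - set as)\<rparr>"
  by (induction as arbitrary: D) (simp_all flip: Diff_insert2)

theorem theorem7p2:
  assumes "infinite (UNIV :: 'a set)"
  shows "(st_reach :: 'a st_graph \<Rightarrow> 'a list set) \<notin> DynPropCQ st_arity 0"
proof
  assume "(st_reach :: 'a st_graph \<Rightarrow> 'a list set) \<in> DynPropCQ st_arity 0"
  then obtain P :: "('a, st_rel, st_const) dyn_program" where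
    prog: "is_dyn_program st_arity P" and ar0: "aux_ar P (query_sym P) = 0" and
    cq: "\<forall>R\<in>aux_syms P. \<forall>\<delta>. conjunctive (upd P R \<delta>) \<and> negation_free (upd P R \<delta>)" and
    maint: "maintains st_arity P st_reach"
    unfolding DynPropCQ_def by blast
  have st_ar: "st_arity R = 2" for R
    by (cases R) simp
  define ar where "ar = case_sum st_arity (aux_ar P)"
  \<comment> \<open>The inserted 2 accounts for the arity of \<open>E\<close>.\<close>
  define K where "K = Max (insert 2 (aux_ar P ` aux_syms P))"
  have fin: "finite (aux_syms P)" and Q: "query_sym P \<in> aux_syms P"
    using prog by (auto simp: is_dyn_program_def)
  have K: "ar R \<le> K" if "R \<in> UNIV <+> aux_syms P" for R
  proof -
    have "2 \<le> K" "\<And>R. R \<in> aux_syms P \<Longrightarrow> aux_ar P R \<le> K"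
      using fin by (auto simp: K_def)
    then show ?thesis
      using that by (cases R) (auto simp: ar_def st_ar)
  qed
  obtain A :: "'a set" where A: "finite A" "card A = K + 1"
    using assms infinite_arbitrarily_large by blast
  obtain s where "s \<notin> A"
    using ex_new_if_finite[OF assms A(1)] by blast
  moreover obtain t where "t \<notin> insert s A"
    using ex_new_if_finite[OF assms, of "insert s A"] A(1) by auto
  moreover obtain c where "c \<notin> insert t (insert s A)"
    using ex_new_if_finite[OF assms, of "insert t (insert s A)"] A(1) by auto
  ultimately have dist: "s \<noteq> t" "s \<noteq> c" "t \<noteq> c" "s \<notin> A" "t \<notin> A" "c \<notin> A"
    by auto
  define B where "B = insert c (insert t (insert s A))"
  obtain xs where xs: "set xs = A"
    using A(1) finite_list by blast
  have "A \<noteq> {}"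
    using A(2) by auto
  define D :: "'a st_graph" where
    "D = \<lparr>univ = B, interp = (\<lambda>_. (\<lambda>a. [s, a]) ` A \<union> (\<lambda>a. [a, t]) ` A),
          cval = (\<lambda>x. case x of s_const \<Rightarrow> s | t_const \<Rightarrow> t)\<rparr>"
  \<comment> \<open>\<open>f j\<close> turns the deletion of \<open>[s, j]\<close> into that of the
    non-edge \<open>[s, c]\<close>.\<close>
  define f :: "'a \<Rightarrow> 'a \<Rightarrow> 'a" where "f j = id(j := c)" for j
  \<comment> \<open>The element \<open>c\<close> is left out because \<open>f j\<close> identifies
    it with \<open>j\<close>.\<close>
  define W where "W = insert s (insert t A)"
  define dels where "dels = map (\<lambda>a. [s, a]) xs"
  have db: "is_db st_arity D"
    using A(1)
    by (auto simp: B_def is_db_def D_def tuples_def st_ar split: st_const.splits)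

  \<comment> \<open>The list \<open>as\<close> is arbitrary so that this covers both
    \<open>dels\<close> and its images under \<open>f j\<close>, which delete a pair that is not an
    edge.\<close>
  have run: "snd (fold (step P) (map (Pair (Del E)) as) (D, init P D)) (query_sym P) =
      st_reach (D\<lparr>interp := (interp D)(E := interp D E - set as)\<rparr>)"
    if "set as \<subseteq> tuples B 2" for as
  proof -
    have "\<forall>m\<in>set (map (Pair (Del E)) as). valid_mod st_arity (univ D) m"
      using that by (auto simp: valid_mod_def D_def)
    then show ?thesis
      using maint db by (simp only: maintains_def fold_apply_mod_Del)
  qed

  have "jointly_reflects A f W (UNIV <+> aux_syms P) ar
      (state_db (D, init P D)) (\<lambda>j. state_db (D, init P D))"
    unfolding jointly_reflects_def
  proof (intro conjI ballI allI impI)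
    show "W \<subseteq> univ (state_db (D, init P D))"
      by (auto simp: B_def W_def state_db_def D_def)
    show "range (cval (state_db (D, init P D))) \<subseteq> W"
      by (auto simp: W_def state_db_def D_def split: st_const.splits)
    show "inj_on (f j) W" for j
      using dist by (auto simp: f_def W_def inj_on_def)
    show "cval (state_db (D, init P D)) x = f j (cval (state_db (D, init P D)) x)" if "j \<in> A" for j x
      using dist that by (auto simp: f_def state_db_def D_def split: st_const.splits)
    show "b \<in> interp (state_db (D, init P D)) R"
      if R: "R \<in> UNIV <+> aux_syms P" and b: "b \<in> tuples W (ar R)"
        and *: "\<forall>j\<in>A. map (f j) b \<in> interp (state_db (D, init P D)) R" for R b
    proof -
      \<comment> \<open>A tuple of length at most \<open>K\<close> misses some \<open>j\<close> in
        \<open>A\<close>. This \<open>f j\<close> fixes the tuple, and all runs start in the same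
        state, so the hypothesis for \<open>j\<close> is already the claim, whatever the
        initialization is.\<close>
      have "card (set b) < card A"
        using card_length[of b] b K[OF R] A(2) by (simp add: tuples_def)
      then obtain j where j: "j \<in> A" "j \<notin> set b"
        by (meson card_mono finite_set leD subsetI)
      then have "map (f j) b = b"
        by (intro map_idI) (auto simp: f_def)
      then show ?thesis
        using * j(1) by metis
    qed
  qed
  moreover have "set dels \<subseteq> tuples W (st_arity E)"
    using xs by (auto simp: dels_def tuples_def W_def)
  ultimately have "jointly_reflects A f W (UNIV <+> aux_syms P) ar
      (state_db (fold (step P) (map (Pair (Del E)) dels) (D, init P D)))
      (\<lambda>j. state_db (fold (step P) (map (\<lambda>a. (Del E, map (f j) a)) dels) (D, init P D)))"
    unfolding ar_def by (intro jointly_reflects_fold_Del \<open>A \<noteq> {}\<close> prog cq)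
  moreover have "Inr (query_sym P) \<in> UNIV <+> aux_syms P" "[] \<in> tuples W (ar (Inr (query_sym P)))"
    using Q by (auto simp: ar_def ar0 tuples_def)
  moreover have "[] \<in> snd (fold (step P) (map (\<lambda>a. (Del E, map (f j) a)) dels) (D, init P D))
      (query_sym P)" if j: "j \<in> A" for j
  proof -
    define as where "as = map (map (f j)) dels"
    have "set as \<subseteq> tuples B 2"
      using xs j dist by (auto simp: B_def as_def dels_def tuples_def f_def)
    note run = run[OF this]
    \<comment> \<open>The path through \<open>j\<close> survives: \<open>f j\<close> never takes the
      value \<open>j\<close>, and every deleted pair starts with \<open>s\<close>, which differs
      from \<open>j\<close>.\<close>
    have "[s, j] \<notin> set as" "[j, t] \<notin> set as"
      using dist j xs by (auto simp: as_def dels_def f_def split: if_splits)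
    then have "(s, j) \<in> edges (D\<lparr>interp := (interp D)(E := interp D E - set as)\<rparr>)"
      "(j, t) \<in> edges (D\<lparr>interp := (interp D)(E := interp D E - set as)\<rparr>)"
      using j by (auto simp: edges_def D_def)
    then have "[] \<in> st_reach (D\<lparr>interp := (interp D)(E := interp D E - set as)\<rparr>)"
      by (auto simp: st_reach_def D_def intro: rtrancl_trans)
    then show ?thesis
      using run by (simp add: as_def comp_def)
  qed
  ultimately have "[] \<in> snd (fold (step P) (map (Pair (Del E)) dels) (D, init P D)) (query_sym P)"
    using jointly_reflectsD[where R = "Inr (query_sym P)" and b = "[]"]
    by (fastforce simp: state_db_def)
  moreover have "set dels \<subseteq> tuples B 2"
    using xs by (auto simp: B_def dels_def tuples_def)
  ultimately have "[] \<in> st_reach (D\<lparr>interp := (interp D)(E := interp D E - set dels)\<rparr>)"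
    using run by metis
  then have "(s, t) \<in> (edges (D\<lparr>interp := (interp D)(E := interp D E - set dels)\<rparr>))\<^sup>*"
    by (simp add: st_reach_def D_def split: if_splits)
  \<comment> \<open>As \<open>s\<close> and \<open>t\<close> differ, a path between them has a first
    edge, but \<open>dels\<close> removed every edge leaving \<open>s\<close>.\<close>
  then obtain y where "(s, y) \<in> edges (D\<lparr>interp := (interp D)(E := interp D E - set dels)\<rparr>)"
    using dist(1) by (meson converse_rtranclE)
  then show False
    using dist xs by (auto simp: edges_def D_def dels_def)
qed

end
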